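(* Every quasi-totally-bounded subset of a metric space $M$ is quasilocated.
   Context: Reasoning is constructive. $\operatorname{glb} T$ is the largest element of the set of lower bounds of a set $T$ of reals; $\delta(x,L)=\operatorname{glb}_{y\in L}d(x,y)$, and $L\subseteq M$ is quasilocated if $\delta(x,L)$ exists for every $x\in M$. $B_\varepsilon(x)$ is the open ball; a set "cannot be empty" if it is not the case that it is empty. An $\varepsilon$-quasiapproximation to $L$ is a finite sequence $x_1,\dots,x_n$ of points of $M$ (not necessarily in $L$) such that $B_\varepsilon(x_i)\cap L$ cannot be empty for each $i$, and $L\subseteq B_\varepsilon(x_1)\cup\dots\cup B_\varepsilon(x_n)$. $L$ is quasi-totally-bounded if for each $\varepsilon>0$ there is an $\varepsilon$-quasiapproximation to $L$. *)

theory Defs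
  imports Complex_Main
begin

text \<open>
  The theorem belongs to constructive mathematics, whereas the logic of HOL is classical.
  With HOL's own connectives the theorem would degenerate: classically every nonempty set of
  distances has a greatest lower bound, whether or not the subset is quasi-totally-bounded.
  The mathematics is therefore stated with truth values in an arbitrary frame (complete Heyting
  algebra) \<open>'h\<close>, i.e. in the standard Heyting-valued semantics of intuitionistic higher-order
  logic. Excluded middle and the axiom of choice fail there in general; for \<open>'h = bool\<close> the
  usual classical notions are recovered (see the end of this theory).
\<close>

class frame = complete_lattice +
  assumes inf_Sup_frame: "inf a (Sup B) = (SUP b\<in>B. inf a b)"

instance bool :: frame
  by standard auto

definition himp :: "'h::frame \<Rightarrow> 'h \<Rightarrow> 'h" (infixr "\<^bold>\<longrightarrow>" 25)
  where "(a \<^bold>\<longrightarrow> b) = Sup {c. inf c a \<le> b}"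

lemma le_himp_iff: "c \<le> (a \<^bold>\<longrightarrow> b) \<longleftrightarrow> inf c a \<le> b"
proof
  assume "c \<le> (a \<^bold>\<longrightarrow> b)"
  then have "inf c a \<le> inf a (Sup {c. inf c a \<le> b})"
    by (simp add: himp_def le_infI1)
  also have "\<dots> \<le> b"
    by (auto simp: inf_Sup_frame inf_commute intro: SUP_least)
  finally show "inf c a \<le> b" .
qed (simp add: himp_def Sup_upper)

abbreviation hconj :: "'h::frame \<Rightarrow> 'h \<Rightarrow> 'h" (infixr "\<^bold>\<and>" 35)
  where "a \<^bold>\<and> b \<equiv> inf a b"

abbreviation hdisj :: "'h::frame \<Rightarrow> 'h \<Rightarrow> 'h" (infixr "\<^bold>\<or>" 30)
  where "a \<^bold>\<or> b \<equiv> sup a b"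

abbreviation hnot :: "'h::frame \<Rightarrow> 'h" ("\<^bold>\<not> _" [40] 40)
  where "\<^bold>\<not> a \<equiv> a \<^bold>\<longrightarrow> bot"

abbreviation hiff :: "'h::frame \<Rightarrow> 'h \<Rightarrow> 'h" (infixr "\<^bold>\<longleftrightarrow>" 25)
  where "(a \<^bold>\<longleftrightarrow> b) \<equiv> (a \<^bold>\<longrightarrow> b) \<^bold>\<and> (b \<^bold>\<longrightarrow> a)"

abbreviation hall :: "('b \<Rightarrow> 'h::frame) \<Rightarrow> 'h" (binder "\<^bold>\<forall>" 10)
  where "hall P \<equiv> Inf (range P)"

abbreviation hex :: "('b \<Rightarrow> 'h::frame) \<Rightarrow> 'h" (binder "\<^bold>\<exists>" 10)
  where "hex P \<equiv> Sup (range P)"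

text \<open>
  Truth value of a fact about the decidable discrete data (rationals, lengths of lists).
\<close>

definition tv :: "bool \<Rightarrow> 'h::frame" ("\<lbrakk>_\<rbrakk>")
  where "\<lbrakk>P\<rbrakk> = (if P then top else bot)"

definition valid :: "'h::frame \<Rightarrow> bool" ("\<Turnstile> _" [5] 5)
  where "(\<Turnstile> a) \<longleftrightarrow> a = top"


section \<open>Dedekind reals\<close>

text \<open>
  \<open>lower r q\<close> and \<open>upper r q\<close> are the truth values of \<open>q < r\<close> and \<open>r < q\<close>. The type of cuts
  contains arbitrary pairs of \<open>'h\<close>-valued sets of rationals; \<open>is_real r\<close> is the truth value of
  \<open>r\<close> being a (two-sided, located) Dedekind real.
\<close>

datatype 'h cut = Cut (lower: "rat \<Rightarrow> 'h") (upper: "rat \<Rightarrow> 'h")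

definition is_real :: "'h::frame cut \<Rightarrow> 'h" where
  "is_real r =
     ((\<^bold>\<exists>q. lower r q) \<^bold>\<and>
      (\<^bold>\<exists>q. upper r q) \<^bold>\<and>
      (\<^bold>\<forall>p. lower r p \<^bold>\<longleftrightarrow> (\<^bold>\<exists>q. \<lbrakk>p < q\<rbrakk> \<^bold>\<and> lower r q)) \<^bold>\<and>
      (\<^bold>\<forall>q. upper r q \<^bold>\<longleftrightarrow> (\<^bold>\<exists>p. \<lbrakk>p < q\<rbrakk> \<^bold>\<and> upper r p)) \<^bold>\<and>
      (\<^bold>\<forall>q. \<^bold>\<not> (lower r q \<^bold>\<and> upper r q)) \<^bold>\<and>
      (\<^bold>\<forall>p q. \<lbrakk>p < q\<rbrakk> \<^bold>\<longrightarrow> lower r p \<^bold>\<or> upper r q))"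

definition real_less :: "'h::frame cut \<Rightarrow> 'h cut \<Rightarrow> 'h" (infix "\<^bold><" 50)
  where "(r \<^bold>< s) = (\<^bold>\<exists>q. upper r q \<^bold>\<and> lower s q)"

definition real_le :: "'h::frame cut \<Rightarrow> 'h cut \<Rightarrow> 'h" (infix "\<^bold>\<le>" 50)
  where "(r \<^bold>\<le> s) = (\<^bold>\<forall>q. lower r q \<^bold>\<longrightarrow> lower s q)"

definition real_eq :: "'h::frame cut \<Rightarrow> 'h cut \<Rightarrow> 'h" (infix "\<^bold>=" 50)
  where "(r \<^bold>= s) = ((r \<^bold>\<le> s) \<^bold>\<and> (s \<^bold>\<le> r))"

definition real_zero :: "'h::frame cut" ("\<^bold>0")
  where "\<^bold>0 = Cut (\<lambda>q. \<lbrakk>q < 0\<rbrakk>) (\<lambda>q. \<lbrakk>0 < q\<rbrakk>)"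

definition real_plus :: "'h::frame cut \<Rightarrow> 'h cut \<Rightarrow> 'h cut" (infixl "\<^bold>+" 65)
  where "r \<^bold>+ s =
    Cut (\<lambda>q. \<^bold>\<exists>a b. \<lbrakk>q = a + b\<rbrakk> \<^bold>\<and> lower r a \<^bold>\<and> lower s b)
        (\<lambda>q. \<^bold>\<exists>a b. \<lbrakk>q = a + b\<rbrakk> \<^bold>\<and> upper r a \<^bold>\<and> upper s b)"

definition lower_bounds :: "('h::frame cut \<Rightarrow> 'h) \<Rightarrow> 'h cut \<Rightarrow> 'h" where
  "lower_bounds T r = (is_real r \<^bold>\<and> (\<^bold>\<forall>t. is_real t \<^bold>\<longrightarrow> T t \<^bold>\<longrightarrow> r \<^bold>\<le> t))"

definition is_glb :: "('h::frame cut \<Rightarrow> 'h) \<Rightarrow> 'h cut \<Rightarrow> 'h" where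
  "is_glb T g = (lower_bounds T g \<^bold>\<and> (\<^bold>\<forall>r. lower_bounds T r \<^bold>\<longrightarrow> r \<^bold>\<le> g))"


section \<open>Metric spaces\<close>

text \<open>
  A space is an \<open>'h\<close>-valued set \<open>M\<close> of elements of a type \<open>'a\<close> (\<open>M x\<close> is the truth value of
  \<open>x \<in> M\<close>) with a distance function. Equality of points of \<open>M\<close> is \<open>d x y \<^bold>= \<^bold>0\<close>, so that the
  axiom ``\<open>d x y = 0\<close> iff \<open>x = y\<close>'' amounts to reflexivity of this relation; symmetry,
  transitivity and extensionality of \<open>d\<close> follow from the other axioms.
\<close>

definition is_metric :: "('a \<Rightarrow> 'h::frame) \<Rightarrow> ('a \<Rightarrow> 'a \<Rightarrow> 'h cut) \<Rightarrow> 'h" where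
  "is_metric M d =
     ((\<^bold>\<forall>x y. M x \<^bold>\<and> M y \<^bold>\<longrightarrow> is_real (d x y) \<^bold>\<and> \<^bold>0 \<^bold>\<le> d x y) \<^bold>\<and>
      (\<^bold>\<forall>x. M x \<^bold>\<longrightarrow> d x x \<^bold>= \<^bold>0) \<^bold>\<and>
      (\<^bold>\<forall>x y. M x \<^bold>\<and> M y \<^bold>\<longrightarrow> d x y \<^bold>= d y x) \<^bold>\<and>
      (\<^bold>\<forall>x y z. M x \<^bold>\<and> M y \<^bold>\<and> M z \<^bold>\<longrightarrow> d x z \<^bold>\<le> d x y \<^bold>+ d y z))"

definition is_subset :: "('a \<Rightarrow> 'h::frame) \<Rightarrow> ('a \<Rightarrow> 'a \<Rightarrow> 'h cut) \<Rightarrow> ('a \<Rightarrow> 'h) \<Rightarrow> 'h" where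
  "is_subset M d L =
     ((\<^bold>\<forall>x. L x \<^bold>\<longrightarrow> M x) \<^bold>\<and>
      (\<^bold>\<forall>x y. L x \<^bold>\<and> M y \<^bold>\<and> d x y \<^bold>= \<^bold>0 \<^bold>\<longrightarrow> L y))"

definition distances :: "('a \<Rightarrow> 'a \<Rightarrow> 'h::frame cut) \<Rightarrow> 'a \<Rightarrow> ('a \<Rightarrow> 'h) \<Rightarrow> 'h cut \<Rightarrow> 'h" where
  "distances d x L t = (\<^bold>\<exists>y. L y \<^bold>\<and> t \<^bold>= d x y)"

text \<open>\<open>\<delta>(x,L)\<close> exists for every point \<open>x\<close>.\<close>

definition quasilocated :: "('a \<Rightarrow> 'h::frame) \<Rightarrow> ('a \<Rightarrow> 'a \<Rightarrow> 'h cut) \<Rightarrow> ('a \<Rightarrow> 'h) \<Rightarrow> 'h" where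
  "quasilocated M d L = (\<^bold>\<forall>x. M x \<^bold>\<longrightarrow> (\<^bold>\<exists>g. is_glb (distances d x L) g))"

definition open_ball ::
    "('a \<Rightarrow> 'h::frame) \<Rightarrow> ('a \<Rightarrow> 'a \<Rightarrow> 'h cut) \<Rightarrow> 'h cut \<Rightarrow> 'a \<Rightarrow> 'a \<Rightarrow> 'h" where
  "open_ball M d \<epsilon> x y = (M y \<^bold>\<and> d x y \<^bold>< \<epsilon>)"

definition is_empty :: "('a \<Rightarrow> 'h::frame) \<Rightarrow> 'h" where
  "is_empty A = (\<^bold>\<not> (\<^bold>\<exists>y. A y))"

text \<open>
  The sequence \<open>x\<^sub>1, \<dots>, x\<^sub>n\<close> has \<open>n \<ge> 1\<close>: the empty sequence would make the empty set, whose set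
  of distances has no largest lower bound, quasi-totally-bounded.
\<close>

definition quasiapproximation ::
    "('a \<Rightarrow> 'h::frame) \<Rightarrow> ('a \<Rightarrow> 'a \<Rightarrow> 'h cut) \<Rightarrow> ('a \<Rightarrow> 'h) \<Rightarrow> 'h cut \<Rightarrow> 'a list \<Rightarrow> 'h" where
  "quasiapproximation M d L \<epsilon> xs =
     (\<lbrakk>xs \<noteq> []\<rbrakk> \<^bold>\<and>
      (INF x\<in>set xs. M x) \<^bold>\<and>
      (INF x\<in>set xs. \<^bold>\<not> is_empty (\<lambda>y. open_ball M d \<epsilon> x y \<^bold>\<and> L y)) \<^bold>\<and>
      (\<^bold>\<forall>y. L y \<^bold>\<longrightarrow> (SUP x\<in>set xs. open_ball M d \<epsilon> x y)))"

definition quasi_totally_bounded ::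
    "('a \<Rightarrow> 'h::frame) \<Rightarrow> ('a \<Rightarrow> 'a \<Rightarrow> 'h cut) \<Rightarrow> ('a \<Rightarrow> 'h) \<Rightarrow> 'h" where
  "quasi_totally_bounded M d L =
     (\<^bold>\<forall>\<epsilon>. is_real \<epsilon> \<^bold>\<and> \<^bold>0 \<^bold>< \<epsilon> \<^bold>\<longrightarrow> (\<^bold>\<exists>xs. quasiapproximation M d L \<epsilon> xs))"


section \<open>The classical case\<close>

text \<open>
  For \<open>'h = bool\<close> and the metric spaces of the library, the notions above are the literal
  classical ones. This serves only as a check of the definitions.
\<close>

definition real_cut :: "real \<Rightarrow> bool cut" where
  "real_cut r = Cut (\<lambda>q. of_rat q < r) (\<lambda>q. r < of_rat q)"

lemma himp_bool [simp]: "(a \<^bold>\<longrightarrow> b) \<longleftrightarrow> (a \<longrightarrow> b)"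
  by (auto simp: himp_def)

lemma tv_bool [simp]: "\<lbrakk>P\<rbrakk> \<longleftrightarrow> P"
  by (simp add: tv_def)

lemma real_le_cut [simp]: "(real_cut r \<^bold>\<le> real_cut s) \<longleftrightarrow> r \<le> s"
proof
  assume *: "real_cut r \<^bold>\<le> real_cut s"
  show "r \<le> s"
  proof (rule ccontr)
    assume "\<not> r \<le> s"
    then obtain q where "s < of_rat q" "of_rat q < r"
      using of_rat_dense[of s r] by auto
    with * show False
      by (auto simp: real_le_def real_cut_def dest!: spec[of _ q])
  qed
qed (auto simp: real_le_def real_cut_def)

lemma real_less_cut [simp]: "(real_cut r \<^bold>< real_cut s) \<longleftrightarrow> r < s"
  by (auto simp: real_less_def real_cut_def dest: of_rat_dense)

lemma real_eq_cut [simp]: "(real_cut r \<^bold>= real_cut s) \<longleftrightarrow> r = s"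
  by (auto simp: real_eq_def)

lemma real_zero_bool: "\<^bold>0 = real_cut 0"
  by (simp add: real_zero_def real_cut_def)

lemma real_plus_cut: "real_cut r \<^bold>+ real_cut s = real_cut (r + s)"
proof -
  have "(\<exists>a b. q = a + b \<and> of_rat a < r \<and> of_rat b < s) \<longleftrightarrow> of_rat q < r + s" for q
  proof
    assume "of_rat q < r + s"
    then obtain a where "of_rat q - s < of_rat a" "of_rat a < r"
      using of_rat_dense[of "of_rat q - s" r] by auto
    then show "\<exists>a b. q = a + b \<and> of_rat a < r \<and> of_rat b < s"
      by (intro exI[of _ a] exI[of _ "q - a"]) (auto simp: of_rat_diff)
  qed (auto simp: of_rat_add)
  moreover have "(\<exists>a b. q = a + b \<and> r < of_rat a \<and> s < of_rat b) \<longleftrightarrow> r + s < of_rat q" for q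
  proof
    assume "r + s < of_rat q"
    then obtain a where "r < of_rat a" "of_rat a < of_rat q - s"
      using of_rat_dense[of r "of_rat q - s"] by auto
    then show "\<exists>a b. q = a + b \<and> r < of_rat a \<and> s < of_rat b"
      by (intro exI[of _ a] exI[of _ "q - a"]) (auto simp: of_rat_diff)
  qed (auto simp: of_rat_add)
  ultimately show ?thesis
    by (simp add: real_plus_def real_cut_def)
qed

lemma is_real_bool_unfold:
  "is_real c \<longleftrightarrow>
     (\<exists>q. lower c q) \<and> (\<exists>q. upper c q) \<and>
     (\<forall>p. (lower c p \<longrightarrow> (\<exists>q>p. lower c q)) \<and> ((\<exists>q>p. lower c q) \<longrightarrow> lower c p)) \<and>
     (\<forall>q. (upper c q \<longrightarrow> (\<exists>p<q. upper c p)) \<and> ((\<exists>p<q. upper c p) \<longrightarrow> upper c q)) \<and>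
     (\<forall>q. \<not> (lower c q \<and> upper c q)) \<and>
     (\<forall>p q. p < q \<longrightarrow> lower c p \<or> upper c q)"
  by (simp add: is_real_def)

lemma is_real_bool: "is_real c \<longleftrightarrow> (\<exists>r. c = real_cut r)"
proof
  assume c: "is_real c"
  define A :: "real set" where "A = of_rat ` {q. lower c q}"
  have lower_open: "lower c p \<longleftrightarrow> (\<exists>q. p < q \<and> lower c q)" for p
    using c unfolding is_real_bool_unfold by blast
  have upper_open: "upper c q \<longleftrightarrow> (\<exists>p. p < q \<and> upper c p)" for q
    using c unfolding is_real_bool_unfold by blast
  have disjoint: "\<not> (lower c q \<and> upper c q)" for q
    using c unfolding is_real_bool_unfold by blast
  have located: "p < q \<Longrightarrow> lower c p \<or> upper c q" for p q
    using c unfolding is_real_bool_unfold by blast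
  have lt: "p < q" if "lower c p" "upper c q" for p q
    using that disjoint lower_open by (metis not_less_iff_gr_or_eq)
  obtain q0 u where q0: "lower c q0" and u: "upper c u"
    using c unfolding is_real_bool_unfold by blast
  have ne: "A \<noteq> {}" using q0 by (auto simp: A_def)
  have bdd: "bdd_above A"
    using lt[OF _ u] by (auto simp: A_def bdd_above_def of_rat_less intro!: exI[of _ "of_rat u"] less_imp_le)
  have low: "lower c q \<longleftrightarrow> of_rat q < Sup A" for q
  proof
    assume "lower c q"
    then obtain p where "q < p" "lower c p" using lower_open by blast
    then have "of_rat p \<le> Sup A" by (auto simp: A_def intro!: cSup_upper bdd[unfolded A_def])
    with \<open>q < p\<close> show "of_rat q < Sup A"
      by (meson less_le_trans of_rat_less)
  next
    assume "of_rat q < Sup A"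
    then obtain p where "q < p" "lower c p"
      using less_cSup_iff[OF ne bdd] by (auto simp: A_def of_rat_less)
    then show "lower c q" using lower_open by blast
  qed
  have up: "upper c q \<longleftrightarrow> Sup A < of_rat q" for q
  proof
    assume "upper c q"
    then obtain p where p: "p < q" "upper c p" using upper_open by blast
    have "Sup A \<le> of_rat p"
      using lt[OF _ p(2)] by (intro cSup_least[OF ne]) (auto simp: A_def of_rat_less intro!: less_imp_le)
    with p(1) show "Sup A < of_rat q"
      by (meson le_less_trans of_rat_less)
  next
    assume "Sup A < of_rat q"
    then obtain p where "Sup A < of_rat p" "of_rat p < (of_rat q :: real)"
      using of_rat_dense by blast
    then show "upper c q" using located[of p q] low[of p] by (auto simp: of_rat_less)
  qed
  have "c = real_cut (Sup A)"
    by (rule cut.expand) (auto simp: real_cut_def low up)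
  then show "\<exists>r. c = real_cut r" ..
next
  assume "\<exists>r. c = real_cut r"
  then obtain r where r: "c = real_cut r" ..
  have 1: "\<exists>q. of_rat q < r" and 2: "\<exists>q. r < of_rat q"
    using of_rat_dense[of "r - 1" r] of_rat_dense[of r "r + 1"] by auto
  have 3: "of_rat p < r \<longleftrightarrow> (\<exists>q>p. of_rat q < r)" for p
    using of_rat_dense[of "of_rat p" r] by (metis of_rat_less order_less_trans)
  have 4: "r < of_rat p \<longleftrightarrow> (\<exists>q<p. r < of_rat q)" for p
    using of_rat_dense[of r "of_rat p"] by (metis of_rat_less order_less_trans)
  have 5: "of_rat p < r \<or> r < of_rat q" if "p < q" for p q
  proof -
    have "of_rat p < (of_rat q :: real)" using that by (simp add: of_rat_less)
    then show ?thesis by linarith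
  qed
  show "is_real c"
    unfolding is_real_bool_unfold r real_cut_def cut.sel
    using 1 2 5 by (simp flip: 3 4)
qed

lemma is_real_cut [simp]: "is_real (real_cut r)"
  by (auto simp: is_real_bool)

lemma all_real_bool: "(\<forall>c. is_real c \<longrightarrow> P c) \<longleftrightarrow> (\<forall>r. P (real_cut r))"
  and ex_real_bool: "(\<exists>c. is_real c \<and> P c) \<longleftrightarrow> (\<exists>r. P (real_cut r))"
  by (auto simp: is_real_bool)

context
  fixes L :: "'a::metric_space set"
begin

private abbreviation (input) "M \<equiv> \<lambda>_::'a. True"
private abbreviation (input) "d \<equiv> \<lambda>x y::'a. real_cut (dist x y)"

lemma is_metric_bool: "is_metric M d"
  by (auto simp: is_metric_def real_zero_bool real_plus_cut dist_commute dist_triangle)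

lemma is_subset_bool: "is_subset M d (\<lambda>y. y \<in> L)"
  by (auto simp: is_subset_def real_zero_bool)

lemma quasilocated_bool:
  "quasilocated M d (\<lambda>y. y \<in> L) \<longleftrightarrow>
     (\<forall>x. \<exists>g. (\<forall>y\<in>L. g \<le> dist x y) \<and> (\<forall>r. (\<forall>y\<in>L. r \<le> dist x y) \<longrightarrow> r \<le> g))"
proof -
  have lb: "lower_bounds (distances d x (\<lambda>y. y \<in> L)) c \<longleftrightarrow>
      is_real c \<and> (\<forall>y\<in>L. c \<^bold>\<le> real_cut (dist x y))" for x c
    by (auto simp: lower_bounds_def distances_def all_real_bool)
  show ?thesis
    by (simp add: quasilocated_def is_glb_def lb conj_assoc ex_real_bool imp_conjL all_real_bool)
qed

lemma quasi_totally_bounded_bool: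
  "quasi_totally_bounded M d (\<lambda>y. y \<in> L) \<longleftrightarrow>
     (\<forall>\<epsilon>>0. \<exists>xs. xs \<noteq> [] \<and> (\<forall>x\<in>set xs. {y. dist x y < \<epsilon>} \<inter> L \<noteq> {}) \<and>
        L \<subseteq> (\<Union>x\<in>set xs. {y. dist x y < \<epsilon>}))"
proof -
  have "{y. dist x y < \<epsilon>} \<inter> L \<noteq> {} \<longleftrightarrow> (\<exists>y. dist x y < \<epsilon> \<and> y \<in> L)" for x \<epsilon>
    by blast
  moreover have "L \<subseteq> (\<Union>x\<in>set xs. {y. dist x y < \<epsilon>}) \<longleftrightarrow>
      (\<forall>y. y \<in> L \<longrightarrow> (\<exists>x\<in>set xs. dist x y < \<epsilon>))" for xs \<epsilon>
    by blast
  ultimately show ?thesis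
    by (simp add: quasi_totally_bounded_def quasiapproximation_def open_ball_def is_empty_def
        real_zero_bool imp_conjL all_real_bool)
qed

end

end

theory Submission
  imports Defs
begin

text \<open>
  Call \<open>p\<close> a bound if \<open>p < d(x,y)\<close> for all \<open>y \<in> L\<close>. The distance \<open>\<delta>(x,L)\<close> is the cut whose lower
  part consists of the rationals below some bound, and whose upper part consists of the rationals
  above some \<open>p\<close> that is not a bound. Only locatedness and boundedness of this cut need an
  \<open>\<epsilon>\<close>-quasiapproximation \<open>x\<^sub>1, \<dots>, x\<^sub>n\<close>: given \<open>a < b\<close>, either \<open>a < d(x,x\<^sub>i)\<close> for all \<open>i\<close>, and then
  \<open>a - \<epsilon>\<close> is a bound, or \<open>d(x,x\<^sub>i) < b\<close> for some \<open>i\<close>, and then \<open>b + \<epsilon>\<close> is not a bound. The second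
  claim is negative, so it suffices that \<open>L\<close> cannot miss the ball around \<open>x\<^sub>i\<close>.

  Proofs in the frame follow Kripke--Joyal semantics: \<open>c \<le> \<phi>\<close> is read as \<open>c\<close> forcing \<open>\<phi>\<close>, and the
  elimination rules pass to smaller truth values.
\<close>

section \<open>Forcing\<close>

lemma forces_exI: "c \<le> P x \<Longrightarrow> c \<le> (\<^bold>\<exists>x. P x)"
  for c :: "'h::frame"
  by (rule order_trans, assumption) (simp add: SUP_upper)

text \<open>The frame law makes \<open>c\<close> the join of the pieces \<open>inf c (P x)\<close>,
  and it suffices to force \<open>\<phi>\<close> on each piece. A witness thus exists only locally,
  which is why \<open>e\<close> varies with \<open>x\<close>.\<close>

lemma forces_SUP_E:
  fixes c :: "'h::frame"
  assumes "c \<le> (SUP x\<in>A. P x)"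
    and "\<And>x e. x \<in> A \<Longrightarrow> e \<le> c \<Longrightarrow> e \<le> P x \<Longrightarrow> e \<le> \<phi>"
  shows "c \<le> \<phi>"
proof -
  have "c = inf c (SUP x\<in>A. P x)"
    using assms(1) by (simp add: inf_absorb1)
  also have "\<dots> = (SUP x\<in>A. inf c (P x))"
    by (simp add: inf_Sup_frame image_image)
  also have "\<dots> \<le> \<phi>"
    by (rule SUP_least) (simp add: assms(2))
  finally show ?thesis .
qed

lemma forces_exE:
  fixes c :: "'h::frame"
  assumes "c \<le> (\<^bold>\<exists>x. P x)" and "\<And>x e. e \<le> c \<Longrightarrow> e \<le> P x \<Longrightarrow> e \<le> \<phi>"
  shows "c \<le> \<phi>"
  using assms(1) by (rule forces_SUP_E) (rule assms(2))

lemma forces_disjE: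
  fixes c :: "'h::frame"
  assumes "c \<le> (a \<^bold>\<or> b)"
    and "\<And>e. e \<le> c \<Longrightarrow> e \<le> a \<Longrightarrow> e \<le> \<phi>"
    and "\<And>e. e \<le> c \<Longrightarrow> e \<le> b \<Longrightarrow> e \<le> \<phi>"
  shows "c \<le> \<phi>"
proof (rule forces_SUP_E)
  show "c \<le> (SUP x\<in>{a, b}. x)"
    using assms(1) by simp
qed (use assms(2,3) in auto)

lemma forces_tvI: "P \<Longrightarrow> c \<le> \<lbrakk>P\<rbrakk>"
  for c :: "'h::frame"
  by (simp add: tv_def)

text \<open>\<open>P\<close> is a fact of the metalogic and does not vary with the truth value, so a
  classical case split on it is harmless: if it fails, \<open>c\<close> is \<open>bot\<close> and
  forces everything.\<close>

lemma forces_tvE: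
  fixes c :: "'h::frame"
  assumes "c \<le> \<lbrakk>P\<rbrakk>" and "P \<Longrightarrow> c \<le> \<phi>"
  shows "c \<le> \<phi>"
  using assms by (cases P) (auto simp: tv_def bot_unique)

lemma forces_botE: "c \<le> bot \<Longrightarrow> c \<le> \<phi>"
  for c :: "'h::frame"
  by (simp add: bot_unique)

lemma forces_impI:
  fixes c :: "'h::frame"
  assumes "\<And>e. e \<le> c \<Longrightarrow> e \<le> a \<Longrightarrow> e \<le> b"
  shows "c \<le> (a \<^bold>\<longrightarrow> b)"
  by (simp add: le_himp_iff assms)

lemma forces_mp: "c \<le> (a \<^bold>\<longrightarrow> b) \<Longrightarrow> c \<le> a \<Longrightarrow> c \<le> b"
  for c :: "'h::frame"
  by (simp add: le_himp_iff inf_absorb1)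

lemma forces_allI: "(\<And>x. c \<le> P x) \<Longrightarrow> c \<le> (\<^bold>\<forall>x. P x)"
  for c :: "'h::frame"
  by (rule INF_greatest)

lemma forces_allD: "c \<le> (\<^bold>\<forall>x. P x) \<Longrightarrow> c \<le> P x"
  for c :: "'h::frame"
  by (simp add: le_INF_iff)

text \<open>A choice between two alternatives for each member is turned into one global alternative.
  Induction on the list does this constructively; here the finiteness of an approximation
  enters.\<close>

lemma forces_list_all_or_ex:
  fixes c :: "'h::frame"
  assumes "\<And>x. x \<in> set xs \<Longrightarrow> c \<le> (P x \<^bold>\<or> Q x)"
  shows "c \<le> ((INF x\<in>set xs. P x) \<^bold>\<or> (SUP x\<in>set xs. Q x))"
  using assms
proof (induction xs)
  case (Cons z zs)
  have "c \<le> (P z \<^bold>\<or> Q z)"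
    using Cons.prems by simp
  then show ?case
  \<comment> \<open>Only the alternative \<open>P z\<close> needs the induction hypothesis;
    \<open>Q z\<close> already gives the right-hand side.\<close>
  proof (rule forces_disjE)
    fix e assume e: "e \<le> c" "e \<le> P z"
    have "e \<le> ((INF x\<in>set zs. P x) \<^bold>\<or> (SUP x\<in>set zs. Q x))"
      using Cons e(1) by (auto intro: order_trans)
    then show "e \<le> ((INF x\<in>set (z # zs). P x) \<^bold>\<or> (SUP x\<in>set (z # zs). Q x))"
      by (rule forces_disjE) (use e(2) in \<open>auto intro: le_supI1 le_supI2 order_trans\<close>)
  qed (auto intro: le_supI1 le_supI2)
qed simp


section \<open>Dedekind reals\<close>

context
  fixes c :: "'h::frame" and r :: "'h cut"
  assumes real: "c \<le> is_real r"
begin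

lemma forces_ex_upper: "c \<le> (\<^bold>\<exists>q. upper r q)"
  using real by (simp add: is_real_def)

lemma forces_lower_open: "c \<le> lower r p \<Longrightarrow> c \<le> (\<^bold>\<exists>q. \<lbrakk>p < q\<rbrakk> \<^bold>\<and> lower r q)"
proof (rule forces_mp)
  have "c \<le> (\<^bold>\<forall>p. lower r p \<^bold>\<longleftrightarrow> (\<^bold>\<exists>q. \<lbrakk>p < q\<rbrakk> \<^bold>\<and> lower r q))"
    using real by (simp add: is_real_def)
  then show "c \<le> (lower r p \<^bold>\<longrightarrow> (\<^bold>\<exists>q. \<lbrakk>p < q\<rbrakk> \<^bold>\<and> lower r q))"
    by (auto dest: forces_allD[where x = p])
qed

lemma forces_lower_mono:
  assumes "c \<le> lower r q" "p \<le> q"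
  shows "c \<le> lower r p"
proof (cases "p = q")
  case False
  have "c \<le> (\<^bold>\<forall>p. lower r p \<^bold>\<longleftrightarrow> (\<^bold>\<exists>q. \<lbrakk>p < q\<rbrakk> \<^bold>\<and> lower r q))"
    using real by (simp add: is_real_def)
  then have "c \<le> ((\<^bold>\<exists>q. \<lbrakk>p < q\<rbrakk> \<^bold>\<and> lower r q) \<^bold>\<longrightarrow> lower r p)"
    by (auto dest: forces_allD[where x = p])
  then show ?thesis
    by (rule forces_mp) (use False assms in \<open>auto intro!: forces_exI[where x = q] forces_tvI\<close>)
qed (use assms in simp)

lemma forces_lower_upper_contradiction:
  assumes "c \<le> lower r p" "c \<le> upper r q" "q \<le> p"
  shows "c \<le> \<phi>"
proof (rule forces_botE)
  have "c \<le> (\<^bold>\<forall>q. \<^bold>\<not> (lower r q \<^bold>\<and> upper r q))"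
    using real by (simp add: is_real_def)
  then have "c \<le> (\<^bold>\<not> (lower r q \<^bold>\<and> upper r q))"
    by (rule forces_allD)
  then show "c \<le> bot"
    by (rule forces_mp) (simp add: assms(2) forces_lower_mono[OF assms(1,3)])
qed

lemma forces_located:
  assumes "p < q"
  shows "c \<le> (lower r p \<^bold>\<or> upper r q)"
proof -
  have "c \<le> (\<^bold>\<forall>p q. \<lbrakk>p < q\<rbrakk> \<^bold>\<longrightarrow> lower r p \<^bold>\<or> upper r q)"
    using real by (simp add: is_real_def)
  then have "c \<le> (\<lbrakk>p < q\<rbrakk> \<^bold>\<longrightarrow> lower r p \<^bold>\<or> upper r q)"
    by (blast dest: forces_allD)
  then show ?thesis
    by (rule forces_mp) (simp add: assms forces_tvI)
qed

end

lemma forces_leD: "c \<le> (r \<^bold>\<le> s) \<Longrightarrow> c \<le> lower r q \<Longrightarrow> c \<le> lower s q"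
  for c :: "'h::frame"
  unfolding real_le_def by (blast dest: forces_allD intro: forces_mp)

lemma forces_leI:
  fixes c :: "'h::frame"
  assumes "\<And>e q. e \<le> c \<Longrightarrow> e \<le> lower r q \<Longrightarrow> e \<le> lower s q"
  shows "c \<le> (r \<^bold>\<le> s)"
  unfolding real_le_def by (intro forces_allI forces_impI assms)

lemma forces_eq_refl: "c \<le> (r \<^bold>= r)"
  for c :: "'h::frame"
  by (simp add: real_eq_def forces_leI)

section \<open>Rational cuts, rounding, and sums of cuts\<close>

text \<open>The embedding of the rationals into the Dedekind reals, which supplies the radii of
  approximations. With rational radii, comparisons stay decidable.\<close>

definition rat_cut :: "rat \<Rightarrow> 'h::frame cut"
  where "rat_cut p = Cut (\<lambda>q. \<lbrakk>q < p\<rbrakk>) (\<lambda>q. \<lbrakk>p < q\<rbrakk>)"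

text \<open>The two openness conditions are taken as equations, not merely as forced at
  \<open>c\<close>, because rational cuts and \<open>dist_cut\<close> satisfy them outright.\<close>

lemma forces_is_realI:
  fixes c :: "'h::frame"
  assumes "c \<le> (\<^bold>\<exists>q. lower r q)" and "c \<le> (\<^bold>\<exists>q. upper r q)"
    and "\<And>p. lower r p = (\<^bold>\<exists>q. \<lbrakk>p < q\<rbrakk> \<^bold>\<and> lower r q)"
    and "\<And>q. upper r q = (\<^bold>\<exists>p. \<lbrakk>p < q\<rbrakk> \<^bold>\<and> upper r p)"
    and "\<And>e q. e \<le> c \<Longrightarrow> e \<le> lower r q \<Longrightarrow> e \<le> upper r q \<Longrightarrow> e \<le> bot"
    and "\<And>p q. p < q \<Longrightarrow> c \<le> (lower r p \<^bold>\<or> upper r q)"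
  shows "c \<le> is_real r"
  unfolding is_real_def
proof (intro le_infI forces_allI)
  fix p q
  show "c \<le> (lower r p \<^bold>\<longrightarrow> (\<^bold>\<exists>q. \<lbrakk>p < q\<rbrakk> \<^bold>\<and> lower r q))"
    by (rule forces_impI, erule order_trans) (rule eq_refl[OF assms(3)])
  show "c \<le> ((\<^bold>\<exists>q. \<lbrakk>p < q\<rbrakk> \<^bold>\<and> lower r q) \<^bold>\<longrightarrow> lower r p)"
    by (rule forces_impI, erule order_trans) (rule eq_refl[OF assms(3)[symmetric]])
  show "c \<le> (upper r q \<^bold>\<longrightarrow> (\<^bold>\<exists>p. \<lbrakk>p < q\<rbrakk> \<^bold>\<and> upper r p))"
    by (rule forces_impI, erule order_trans) (rule eq_refl[OF assms(4)])
  show "c \<le> ((\<^bold>\<exists>p. \<lbrakk>p < q\<rbrakk> \<^bold>\<and> upper r p) \<^bold>\<longrightarrow> upper r q)"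
    by (rule forces_impI, erule order_trans) (rule eq_refl[OF assms(4)[symmetric]])
  show "c \<le> (\<^bold>\<not> (lower r q \<^bold>\<and> upper r q))"
    by (rule forces_impI) (use assms(5) in auto)
  show "c \<le> (\<lbrakk>p < q\<rbrakk> \<^bold>\<longrightarrow> lower r p \<^bold>\<or> upper r q)"
    by (rule forces_impI) (auto elim!: forces_tvE intro: order_trans assms(6))
qed (fact assms(1) assms(2))+

text \<open>Density of the rationals makes rounding down idempotent. This gives openness of the
  lower part of \<open>dist_cut\<close>, which is defined as such a rounding.\<close>

lemma ex_greater_idem:
  fixes A :: "rat \<Rightarrow> 'h::frame"
  shows "(\<^bold>\<exists>q. \<lbrakk>p < q\<rbrakk> \<^bold>\<and> A q) = (\<^bold>\<exists>q. \<lbrakk>p < q\<rbrakk> \<^bold>\<and> (\<^bold>\<exists>q'. \<lbrakk>q < q'\<rbrakk> \<^bold>\<and> A q'))" (is "?l = ?r")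
proof (rule antisym)
  show "?l \<le> ?r"
  proof (rule forces_exE[OF order_refl], unfold le_inf_iff, elim conjE forces_tvE)
    fix q e assume "e \<le> A q" "p < q"
    moreover obtain s where "p < s" "s < q"
      using \<open>p < q\<close> dense by blast
    ultimately have "e \<le> (\<lbrakk>p < s\<rbrakk> \<^bold>\<and> \<lbrakk>s < q\<rbrakk> \<^bold>\<and> A q)"
      by (simp add: forces_tvI)
    then show "e \<le> ?r"
      by (intro forces_exI[where x = s]) (auto intro: forces_exI[where x = q])
  qed
  show "?r \<le> ?l"
  proof (rule forces_exE[OF order_refl], unfold le_inf_iff, elim conjE forces_tvE)
    fix q e assume e: "e \<le> (\<^bold>\<exists>q'. \<lbrakk>q < q'\<rbrakk> \<^bold>\<and> A q')" "p < q"
    from e(1) show "e \<le> ?l"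
    proof (rule forces_exE, unfold le_inf_iff, elim conjE forces_tvE)
      fix q' e assume "e \<le> A q'" "q < q'"
      then show "e \<le> ?l"
        using \<open>p < q\<close> by (intro forces_exI[where x = q']) (simp add: forces_tvI)
    qed
  qed
qed

text \<open>Reflection of the rationals by \<open>q \<mapsto> - q\<close> reduces rounding up to
  rounding down.\<close>

lemma ex_less_idem:
  fixes A :: "rat \<Rightarrow> 'h::frame"
  shows "(\<^bold>\<exists>p. \<lbrakk>p < q\<rbrakk> \<^bold>\<and> A p) = (\<^bold>\<exists>p. \<lbrakk>p < q\<rbrakk> \<^bold>\<and> (\<^bold>\<exists>p'. \<lbrakk>p' < p\<rbrakk> \<^bold>\<and> A p'))"
proof -
  have neg: "(\<^bold>\<exists>p. \<lbrakk>p < s\<rbrakk> \<^bold>\<and> B p) = (\<^bold>\<exists>p. \<lbrakk>- s < p\<rbrakk> \<^bold>\<and> B (- p))" for s and B :: "rat \<Rightarrow> 'h"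
  proof -
    have "range (\<lambda>p. \<lbrakk>p < s\<rbrakk> \<^bold>\<and> B p) = (\<lambda>p. \<lbrakk>p < s\<rbrakk> \<^bold>\<and> B p) ` range uminus"
      by (simp only: surjI[of uminus uminus, OF minus_minus])
    also have "\<dots> = range (\<lambda>p. \<lbrakk>- s < p\<rbrakk> \<^bold>\<and> B (- p))"
      by (simp only: image_image minus_less_iff[of _ s])
    finally show ?thesis
      by (rule arg_cong)
  qed
  show ?thesis
    unfolding neg[of _ A] neg[of q] using ex_greater_idem[of "- q" "\<lambda>p. A (- p)"] by simp
qed

lemma forces_rat_cut_real: "c \<le> is_real (rat_cut p)"
  for c :: "'h::frame"
proof (rule forces_is_realI)
  show "c \<le> (\<^bold>\<exists>q. lower (rat_cut p) q)"
    by (rule forces_exI[where x = "p - 1"]) (simp add: rat_cut_def forces_tvI)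
  show "c \<le> (\<^bold>\<exists>q. upper (rat_cut p) q)"
    by (rule forces_exI[where x = "p + 1"]) (simp add: rat_cut_def forces_tvI)
  show "lower (rat_cut p) s = (\<^bold>\<exists>q. \<lbrakk>s < q\<rbrakk> \<^bold>\<and> lower (rat_cut p :: 'h cut) q)" for s
  proof (rule antisym)
    show "lower (rat_cut p) s \<le> (\<^bold>\<exists>q. \<lbrakk>s < q\<rbrakk> \<^bold>\<and> lower (rat_cut p :: 'h cut) q)"
      unfolding rat_cut_def cut.sel
    proof (rule forces_tvE[OF order_refl])
      assume "s < p"
      then obtain q where "s < q" "q < p"
        using dense by blast
      then show "\<lbrakk>s < p\<rbrakk> \<le> (\<^bold>\<exists>q. \<lbrakk>s < q\<rbrakk> \<^bold>\<and> (\<lbrakk>q < p\<rbrakk> :: 'h))"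
        by (intro forces_exI[where x = q]) (simp add: forces_tvI)
    qed
  qed (auto simp: rat_cut_def tv_def intro!: SUP_least)
  show "upper (rat_cut p) s = (\<^bold>\<exists>q. \<lbrakk>q < s\<rbrakk> \<^bold>\<and> upper (rat_cut p :: 'h cut) q)" for s
  proof (rule antisym)
    show "upper (rat_cut p) s \<le> (\<^bold>\<exists>q. \<lbrakk>q < s\<rbrakk> \<^bold>\<and> upper (rat_cut p :: 'h cut) q)"
      unfolding rat_cut_def cut.sel
    proof (rule forces_tvE[OF order_refl])
      assume "p < s"
      then obtain q where "p < q" "q < s"
        using dense by blast
      then show "\<lbrakk>p < s\<rbrakk> \<le> (\<^bold>\<exists>q. \<lbrakk>q < s\<rbrakk> \<^bold>\<and> (\<lbrakk>p < q\<rbrakk> :: 'h))"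
        by (intro forces_exI[where x = q]) (simp add: forces_tvI)
    qed
  qed (auto simp: rat_cut_def tv_def intro!: SUP_least)
qed (auto simp: rat_cut_def tv_def split: if_splits)

lemma forces_rat_cut_pos:
  fixes c :: "'h::frame"
  assumes "0 < p"
  shows "c \<le> (\<^bold>0 \<^bold>< rat_cut p)"
proof -
  obtain q where "0 < q" "q < p"
    using assms dense by blast
  then show ?thesis
    unfolding real_less_def real_zero_def rat_cut_def
    by (intro forces_exI[where x = q]) (simp add: forces_tvI)
qed

lemma forces_less_rat_cutE:
  fixes c :: "'h::frame"
  assumes "c \<le> (r \<^bold>< rat_cut p)" and "\<And>e q. e \<le> c \<Longrightarrow> e \<le> upper r q \<Longrightarrow> q < p \<Longrightarrow> e \<le> \<phi>"
  shows "c \<le> \<phi>"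
  using assms(1) unfolding real_less_def
  by (rule forces_exE) (auto simp: rat_cut_def elim!: forces_tvE intro: assms(2))

lemma forces_lower_plusE:
  fixes c :: "'h::frame"
  assumes "c \<le> lower (r \<^bold>+ s) q"
    and "\<And>e a b. e \<le> c \<Longrightarrow> q = a + b \<Longrightarrow> e \<le> lower r a \<Longrightarrow> e \<le> lower s b \<Longrightarrow> e \<le> \<phi>"
  shows "c \<le> \<phi>"
proof -
  have "c \<le> (\<^bold>\<exists>a b. \<lbrakk>q = a + b\<rbrakk> \<^bold>\<and> lower r a \<^bold>\<and> lower s b)"
    using assms(1) by (simp add: real_plus_def)
  then show ?thesis
  proof (rule forces_exE)
    fix a e assume e: "e \<le> c" "e \<le> (\<^bold>\<exists>b. \<lbrakk>q = a + b\<rbrakk> \<^bold>\<and> lower r a \<^bold>\<and> lower s b)"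
    from e(2) show "e \<le> \<phi>"
    proof (rule forces_exE, unfold le_inf_iff, elim conjE forces_tvE)
      fix b e' assume "e' \<le> e" "q = a + b" "e' \<le> lower r a" "e' \<le> lower s b"
      then show "e' \<le> \<phi>"
        using e(1) assms(2) order_trans by blast
    qed
  qed
qed


section \<open>Metric spaces\<close>

context
  fixes M :: "'a \<Rightarrow> 'h::frame" and d :: "'a \<Rightarrow> 'a \<Rightarrow> 'h cut" and c :: 'h
  assumes metric: "c \<le> is_metric M d"
begin

lemma forces_dist_real: "c \<le> M x \<Longrightarrow> c \<le> M y \<Longrightarrow> c \<le> is_real (d x y)"
proof -
  assume "c \<le> M x" "c \<le> M y"
  moreover have "c \<le> (\<^bold>\<forall>x y. M x \<^bold>\<and> M y \<^bold>\<longrightarrow> is_real (d x y) \<^bold>\<and> \<^bold>0 \<^bold>\<le> d x y)"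
    using metric by (simp add: is_metric_def)
  then have "c \<le> (M x \<^bold>\<and> M y \<^bold>\<longrightarrow> is_real (d x y) \<^bold>\<and> \<^bold>0 \<^bold>\<le> d x y)"
    by (blast dest: forces_allD)
  ultimately show ?thesis
    by (auto dest: forces_mp)
qed

lemma forces_dist_nonneg: "c \<le> M x \<Longrightarrow> c \<le> M y \<Longrightarrow> c \<le> (\<^bold>0 \<^bold>\<le> d x y)"
proof -
  assume "c \<le> M x" "c \<le> M y"
  moreover have "c \<le> (\<^bold>\<forall>x y. M x \<^bold>\<and> M y \<^bold>\<longrightarrow> is_real (d x y) \<^bold>\<and> \<^bold>0 \<^bold>\<le> d x y)"
    using metric by (simp add: is_metric_def)
  then have "c \<le> (M x \<^bold>\<and> M y \<^bold>\<longrightarrow> is_real (d x y) \<^bold>\<and> \<^bold>0 \<^bold>\<le> d x y)"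
    by (blast dest: forces_allD)
  ultimately show ?thesis
    by (auto dest: forces_mp)
qed

lemma forces_dist_sym: "c \<le> M x \<Longrightarrow> c \<le> M y \<Longrightarrow> c \<le> (d x y \<^bold>\<le> d y x)"
proof -
  assume "c \<le> M x" "c \<le> M y"
  moreover have "c \<le> (\<^bold>\<forall>x y. M x \<^bold>\<and> M y \<^bold>\<longrightarrow> d x y \<^bold>= d y x)"
    using metric by (simp add: is_metric_def)
  then have "c \<le> (M x \<^bold>\<and> M y \<^bold>\<longrightarrow> d x y \<^bold>= d y x)"
    by (blast dest: forces_allD)
  ultimately show ?thesis
    by (auto dest: forces_mp simp: real_eq_def)
qed

lemma forces_dist_triangle:
  "c \<le> M x \<Longrightarrow> c \<le> M y \<Longrightarrow> c \<le> M z \<Longrightarrow> c \<le> (d x z \<^bold>\<le> d x y \<^bold>+ d y z)"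
proof -
  assume "c \<le> M x" "c \<le> M y" "c \<le> M z"
  moreover have "c \<le> (\<^bold>\<forall>x y z. M x \<^bold>\<and> M y \<^bold>\<and> M z \<^bold>\<longrightarrow> d x z \<^bold>\<le> d x y \<^bold>+ d y z)"
    using metric by (simp add: is_metric_def)
  then have "c \<le> (M x \<^bold>\<and> M y \<^bold>\<and> M z \<^bold>\<longrightarrow> d x z \<^bold>\<le> d x y \<^bold>+ d y z)"
    by (blast dest: forces_allD)
  ultimately show ?thesis
    by (auto dest: forces_mp)
qed

end

section \<open>Comparing the distances from \<open>x\<close> to two nearby points\<close>

text \<open>From \<open>a < d x z\<close> and the triangle inequality, \<open>a = u + v\<close> with
  \<open>u < d x y\<close> and \<open>v < d y z\<close>. Since \<open>d z y < \<epsilon>\<close>,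
  also \<open>v < \<epsilon>\<close>, hence \<open>a - \<epsilon> < u\<close>.\<close>

lemma forces_lower_dist_ball:
  fixes c :: "'h::frame"
  assumes metric: "c \<le> is_metric M d" and M: "c \<le> M x" "c \<le> M z" "c \<le> M y"
    and "c \<le> (d z y \<^bold>< rat_cut \<epsilon>)" "c \<le> lower (d x z) a"
  shows "c \<le> lower (d x y) (a - \<epsilon>)"
  using assms(5)
proof (rule forces_less_rat_cutE)
  fix e q assume e: "e \<le> c" "e \<le> upper (d z y) q" and q: "q < \<epsilon>"
  have "e \<le> lower (d x y \<^bold>+ d y z) a"
    using forces_leD[OF forces_dist_triangle[OF metric M(1,3,2)] assms(6)] e(1) by (rule order_trans[rotated])
  then show "e \<le> lower (d x y) (a - \<epsilon>)"
  proof (rule forces_lower_plusE)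
    fix e' u v
    assume e': "e' \<le> e" and uv: "a = u + v" "e' \<le> lower (d x y) u" "e' \<le> lower (d y z) v"
    have c: "e' \<le> c"
      using e e' by simp
    note fs = order_trans[OF c]
    have zy: "e' \<le> lower (d z y) v"
      by (rule forces_leD[OF fs[OF forces_dist_sym[OF metric M(3,2)]] uv(3)])
    show "e' \<le> lower (d x y) (a - \<epsilon>)"
    \<comment> \<open>Order on the rationals is decidable, so this split is constructive. The first
      case contradicts \<open>v < d z y < q\<close>; in the second,
      \<open>v < q < \<epsilon>\<close>.\<close>
    proof (cases "q \<le> v")
      case True
      show ?thesis
        by (rule forces_lower_upper_contradiction[OF fs[OF forces_dist_real[OF metric M(2,3)]] zy
              order_trans[OF e' e(2)] True])
    next
      case False
      then show ?thesis
        by (intro forces_lower_mono[OF fs[OF forces_dist_real[OF metric M(1,3)]] uv(2)])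
          (use q uv(1) in simp)
    qed
  qed
qed

text \<open>The triangle inequality splits \<open>b + \<epsilon>\<close> as \<open>u + v\<close>
  with \<open>u < d x z\<close> and \<open>v < d z y\<close>. Either \<open>b \<le> u\<close>,
  against \<open>d x z < b\<close>, or \<open>v > \<epsilon>\<close>, against
  \<open>d z y < \<epsilon>\<close>.\<close>

lemma forces_not_lower_dist_ball:
  fixes c :: "'h::frame"
  assumes metric: "c \<le> is_metric M d" and M: "c \<le> M x" "c \<le> M z" "c \<le> M y"
    and "c \<le> (d z y \<^bold>< rat_cut \<epsilon>)" "c \<le> upper (d x z) b" "c \<le> lower (d x y) (b + \<epsilon>)"
  shows "c \<le> bot"
proof -
  have "c \<le> lower (d x z \<^bold>+ d z y) (b + \<epsilon>)"
    by (rule forces_leD[OF forces_dist_triangle[OF metric M] assms(7)])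
  then show ?thesis
  proof (rule forces_lower_plusE)
    fix e u v
    assume e: "e \<le> c" and uv: "b + \<epsilon> = u + v" "e \<le> lower (d x z) u" "e \<le> lower (d z y) v"
    show "e \<le> bot"
    proof (cases "b \<le> u")
      case True
      show ?thesis
        by (rule forces_lower_upper_contradiction[OF
              order_trans[OF e forces_dist_real[OF metric M(1,2)]] uv(2) order_trans[OF e assms(6)] True])
    next
      case False
      from order_trans[OF e assms(5)] show ?thesis
      proof (rule forces_less_rat_cutE)
        fix e' q assume e': "e' \<le> e" "e' \<le> upper (d z y) q" and "q < \<epsilon>"
        then have "q \<le> v"
          using False uv(1) by simp
        moreover have "e' \<le> is_real (d z y)"
          using forces_dist_real[OF metric M(2,3)] e e'(1) by (meson order_trans)
        ultimately show "e' \<le> bot"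
          using forces_lower_upper_contradiction order_trans[OF e'(1) uv(3)] e'(2) by blast
      qed
    qed
  qed
qed


section \<open>The distance to a subset\<close>

definition dist_bound :: "('a \<Rightarrow> 'a \<Rightarrow> 'h::frame cut) \<Rightarrow> 'a \<Rightarrow> ('a \<Rightarrow> 'h) \<Rightarrow> rat \<Rightarrow> 'h" where
  "dist_bound d x L p = (\<^bold>\<forall>y. L y \<^bold>\<longrightarrow> lower (d x y) p)"

text \<open>The upper part uses a negated bound instead of a point of \<open>L\<close> at distance
  below \<open>q\<close>, since an approximation only says that its balls cannot miss
  \<open>L\<close>. The strict rounding makes both parts open, even when there is a largest
  bound.\<close>

definition dist_cut :: "('a \<Rightarrow> 'a \<Rightarrow> 'h::frame cut) \<Rightarrow> 'a \<Rightarrow> ('a \<Rightarrow> 'h) \<Rightarrow> 'h cut" where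
  "dist_cut d x L =
     Cut (\<lambda>q. \<^bold>\<exists>p. \<lbrakk>q < p\<rbrakk> \<^bold>\<and> dist_bound d x L p) (\<lambda>q. \<^bold>\<exists>p. \<lbrakk>p < q\<rbrakk> \<^bold>\<and> \<^bold>\<not> dist_bound d x L p)"

lemma forces_dist_boundD: "c \<le> dist_bound d x L p \<Longrightarrow> c \<le> L y \<Longrightarrow> c \<le> lower (d x y) p"
  for c :: "'h::frame"
  unfolding dist_bound_def by (blast dest: forces_allD intro: forces_mp)

lemma forces_dist_boundI:
  fixes c :: "'h::frame"
  assumes "\<And>e y. e \<le> c \<Longrightarrow> e \<le> L y \<Longrightarrow> e \<le> lower (d x y) p"
  shows "c \<le> dist_bound d x L p"
  unfolding dist_bound_def by (intro forces_allI forces_impI assms)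

lemma forces_lower_dist_cutI: "c \<le> dist_bound d x L p \<Longrightarrow> q < p \<Longrightarrow> c \<le> lower (dist_cut d x L) q"
  for c :: "'h::frame"
  unfolding dist_cut_def by (auto intro!: forces_exI[where x = p] forces_tvI)

lemma forces_upper_dist_cutI:
  "c \<le> (\<^bold>\<not> dist_bound d x L p) \<Longrightarrow> p < q \<Longrightarrow> c \<le> upper (dist_cut d x L) q"
  for c :: "'h::frame"
  unfolding dist_cut_def by (auto intro!: forces_exI[where x = p] forces_tvI)

lemma forces_lower_dist_cutE:
  fixes c :: "'h::frame"
  assumes "c \<le> lower (dist_cut d x L) q"
    and "\<And>e p. e \<le> c \<Longrightarrow> q < p \<Longrightarrow> e \<le> dist_bound d x L p \<Longrightarrow> e \<le> \<phi>"
  shows "c \<le> \<phi>"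
  using assms(1) unfolding dist_cut_def cut.sel
  by (rule forces_exE) (auto elim!: forces_tvE intro: assms(2))

lemma forces_upper_dist_cutE:
  fixes c :: "'h::frame"
  assumes "c \<le> upper (dist_cut d x L) q"
    and "\<And>e p. e \<le> c \<Longrightarrow> p < q \<Longrightarrow> e \<le> (\<^bold>\<not> dist_bound d x L p) \<Longrightarrow> e \<le> \<phi>"
  shows "c \<le> \<phi>"
  using assms(1) unfolding dist_cut_def cut.sel
  by (rule forces_exE) (auto elim!: forces_tvE intro: assms(2))

lemma forces_subsetD: "c \<le> is_subset M d L \<Longrightarrow> c \<le> L y \<Longrightarrow> c \<le> M y"
  for c :: "'h::frame"
  unfolding is_subset_def le_inf_iff by (blast dest: forces_allD intro: forces_mp)

lemma forces_quasiapproximationE: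
  fixes c :: "'h::frame"
  assumes "c \<le> quasi_totally_bounded M d L" "0 < \<epsilon>"
    and "\<And>e xs. e \<le> c \<Longrightarrow> e \<le> quasiapproximation M d L (rat_cut \<epsilon>) xs \<Longrightarrow> e \<le> \<phi>"
  shows "c \<le> \<phi>"
proof -
  have "c \<le> (is_real (rat_cut \<epsilon>) \<^bold>\<and> \<^bold>0 \<^bold>< rat_cut \<epsilon> \<^bold>\<longrightarrow>
      (\<^bold>\<exists>xs. quasiapproximation M d L (rat_cut \<epsilon>) xs))"
    using assms(1) unfolding quasi_totally_bounded_def by (rule forces_allD)
  then have "c \<le> (\<^bold>\<exists>xs. quasiapproximation M d L (rat_cut \<epsilon>) xs)"
    by (rule forces_mp) (simp add: forces_rat_cut_real forces_rat_cut_pos assms(2))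
  then show ?thesis
    by (rule forces_exE) (rule assms(3))
qed

section \<open>Bounds obtained from an approximation\<close>

context
  fixes M :: "'a \<Rightarrow> 'h::frame" and d :: "'a \<Rightarrow> 'a \<Rightarrow> 'h cut" and L :: "'a \<Rightarrow> 'h"
    and x :: 'a and c :: 'h
  assumes metric: "c \<le> is_metric M d" and subset: "c \<le> is_subset M d L" and x: "c \<le> M x"
begin

lemma forces_dist_bound_approx:
  assumes "c \<le> quasiapproximation M d L (rat_cut \<epsilon>) xs"
    and "c \<le> (INF z\<in>set xs. lower (d x z) a)"
  shows "c \<le> dist_bound d x L (a - \<epsilon>)"
proof (rule forces_dist_boundI)
  fix e y assume e: "e \<le> c" "e \<le> L y"
  have "c \<le> (\<^bold>\<forall>y. L y \<^bold>\<longrightarrow> (SUP z\<in>set xs. open_ball M d (rat_cut \<epsilon>) z y))"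
    using assms(1) by (simp add: quasiapproximation_def)
  then have "e \<le> (L y \<^bold>\<longrightarrow> (SUP z\<in>set xs. open_ball M d (rat_cut \<epsilon>) z y))"
    using e(1) by (blast dest: forces_allD intro: order_trans)
  then have "e \<le> (SUP z\<in>set xs. open_ball M d (rat_cut \<epsilon>) z y)"
    using e(2) by (rule forces_mp)
  then show "e \<le> lower (d x y) (a - \<epsilon>)"
  \<comment> \<open>The centre whose ball contains \<open>y\<close> is known only locally; the bound
    obtained does not mention it, so the pieces fit together.\<close>
  proof (rule forces_SUP_E)
    fix z e' assume z: "z \<in> set xs" and e': "e' \<le> e" "e' \<le> open_ball M d (rat_cut \<epsilon>) z y"
    have c: "e' \<le> c"
      using e(1) e'(1) by simp
    have "c \<le> M z" "c \<le> lower (d x z) a"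
      using assms z by (auto simp: quasiapproximation_def le_INF_iff)
    with c e'(2) show "e' \<le> lower (d x y) (a - \<epsilon>)"
      by (intro forces_lower_dist_ball[where M = M and z = z])
        (auto simp: open_ball_def intro: order_trans metric x)
  qed
qed

text \<open>If \<open>b + \<epsilon>\<close> were a bound, no point of \<open>L\<close> could lie in
  the ball around \<open>z\<close>, whereas this intersection cannot be empty. No point of it has to
  be produced.\<close>

lemma forces_not_dist_bound_approx:
  assumes "c \<le> quasiapproximation M d L (rat_cut \<epsilon>) xs"
    and z: "z \<in> set xs" and b: "c \<le> upper (d x z) b"
  shows "c \<le> (\<^bold>\<not> dist_bound d x L (b + \<epsilon>))"
proof (rule forces_impI)
  fix e assume e: "e \<le> c" "e \<le> dist_bound d x L (b + \<epsilon>)"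
  let ?S = "\<lambda>y. open_ball M d (rat_cut \<epsilon>) z y \<^bold>\<and> L y"
  have Mz: "c \<le> M z" and "c \<le> (\<^bold>\<not> is_empty ?S)"
    using assms(1) z by (auto simp: quasiapproximation_def le_INF_iff)
  then have "e \<le> (\<^bold>\<not> is_empty ?S)"
    using e(1) by (blast intro: order_trans)
  moreover have "e \<le> is_empty ?S"
    unfolding is_empty_def
  proof (rule forces_impI)
    fix e' assume e': "e' \<le> e" "e' \<le> (\<^bold>\<exists>y. ?S y)"
    from e'(2) show "e' \<le> bot"
    proof (rule forces_exE)
      fix y e'' assume e'': "e'' \<le> e'" "e'' \<le> ?S y"
      have c: "e'' \<le> c" and "e'' \<le> dist_bound d x L (b + \<epsilon>)"
        using e e'(1) e''(1) by auto
      then show "e'' \<le> bot"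
        using e''(2)
        by (intro forces_not_lower_dist_ball[where M = M and z = z and x = x and y = y])
          (auto simp: open_ball_def intro: order_trans metric x Mz b forces_dist_boundD)
    qed
  qed
  ultimately show "e \<le> bot"
    by (rule forces_mp)
qed

text \<open>Distances are nonnegative; this makes the lower part of \<open>dist_cut\<close>
  inhabited.\<close>

lemma forces_dist_bound_neg: "p < 0 \<Longrightarrow> c \<le> dist_bound d x L p"
proof (rule forces_dist_boundI)
  fix e y assume "p < 0" and e: "e \<le> c" "e \<le> L y"
  note fs = order_trans[OF e(1)]
  have "e \<le> (\<^bold>0 \<^bold>\<le> d x y)"
    by (intro forces_dist_nonneg[OF fs[OF metric] fs[OF x]] forces_subsetD[OF fs[OF subset] e(2)])
  then show "e \<le> lower (d x y) p"
    by (rule forces_leD) (simp add: real_zero_def forces_tvI \<open>p < 0\<close>)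
qed

lemma forces_dist_bound_mono:
  assumes "c \<le> dist_bound d x L p" "q \<le> p"
  shows "c \<le> dist_bound d x L q"
proof (rule forces_dist_boundI)
  fix e y assume e: "e \<le> c" "e \<le> L y"
  note fs = order_trans[OF e(1)]
  have "e \<le> is_real (d x y)"
    by (intro forces_dist_real[OF fs[OF metric] fs[OF x]] forces_subsetD[OF fs[OF subset] e(2)])
  then show "e \<le> lower (d x y) q"
    using forces_dist_boundD[OF fs[OF assms(1)] e(2)] assms(2) by (rule forces_lower_mono)
qed

end

section \<open>The distance cut is a Dedekind real\<close>

lemma forces_dist_cut_located:
  fixes c :: "'h::frame"
  assumes metric: "c \<le> is_metric M d" and subset: "c \<le> is_subset M d L" and x: "c \<le> M x"
    and qtb: "c \<le> quasi_totally_bounded M d L" and "p < q"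
  shows "c \<le> (lower (dist_cut d x L) p \<^bold>\<or> upper (dist_cut d x L) q)"
proof -
  \<comment> \<open>Five equal steps: each centre is tested between
    \<open>p + 2 * \<epsilon>\<close> and \<open>p + 3 * \<epsilon>\<close>, passing to points of
    \<open>L\<close> costs one step on either side, and the outer steps supply the strict
    inequalities of the cut.\<close>
  define \<epsilon> where "\<epsilon> = (q - p) / 5"
  have \<epsilon>: "0 < \<epsilon>" and q: "q = p + 5 * \<epsilon>"
    using \<open>p < q\<close> by (auto simp: \<epsilon>_def field_simps)
  show ?thesis
    using qtb \<epsilon>
  proof (rule forces_quasiapproximationE)
    fix e xs assume e: "e \<le> c" and xs: "e \<le> quasiapproximation M d L (rat_cut \<epsilon>) xs"
    note fs = order_trans[OF e]
    have "e \<le> (lower (d x z) (p + 2 * \<epsilon>) \<^bold>\<or> upper (d x z) (p + 3 * \<epsilon>))" if "z \<in> set xs" for z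
    proof (rule forces_located)
      have "e \<le> M z"
        using xs that by (auto simp: quasiapproximation_def le_INF_iff)
      then show "e \<le> is_real (d x z)"
        by (rule forces_dist_real[OF fs[OF metric] fs[OF x]])
    qed (use \<epsilon> in simp)
    \<comment> \<open>Either all centres are far from \<open>x\<close>, which yields a bound, or one
      is near, which refutes one.\<close>
    then have "e \<le> ((INF z\<in>set xs. lower (d x z) (p + 2 * \<epsilon>)) \<^bold>\<or>
        (SUP z\<in>set xs. upper (d x z) (p + 3 * \<epsilon>)))"
      by (rule forces_list_all_or_ex)
    then show "e \<le> (lower (dist_cut d x L) p \<^bold>\<or> upper (dist_cut d x L) q)"
    proof (rule forces_disjE)
      fix e' assume e': "e' \<le> e" "e' \<le> (INF z\<in>set xs. lower (d x z) (p + 2 * \<epsilon>))"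
      note fs' = order_trans[OF e'(1) fs]
      have "e' \<le> dist_bound d x L (p + 2 * \<epsilon> - \<epsilon>)"
        by (rule forces_dist_bound_approx[OF fs'[OF metric] fs'[OF subset] fs'[OF x]
              order_trans[OF e'(1) xs] e'(2)])
      then have "e' \<le> lower (dist_cut d x L) p"
        by (rule forces_lower_dist_cutI) (use \<epsilon> in simp)
      then show "e' \<le> (lower (dist_cut d x L) p \<^bold>\<or> upper (dist_cut d x L) q)"
        by (rule le_supI1)
    next
      fix e' assume e': "e' \<le> e" "e' \<le> (SUP z\<in>set xs. upper (d x z) (p + 3 * \<epsilon>))"
      from e'(2) have "e' \<le> upper (dist_cut d x L) q"
      proof (rule forces_SUP_E)
        fix z e'' assume z: "z \<in> set xs" and e'': "e'' \<le> e'" "e'' \<le> upper (d x z) (p + 3 * \<epsilon>)"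
        note fs'' = order_trans[OF e''(1) order_trans[OF e'(1)]]
        have "e'' \<le> (\<^bold>\<not> dist_bound d x L (p + 3 * \<epsilon> + \<epsilon>))"
          by (rule forces_not_dist_bound_approx[OF fs''[OF fs[OF metric]] fs''[OF fs[OF subset]]
                fs''[OF fs[OF x]] fs''[OF xs] z e''(2)])
        then show "e'' \<le> upper (dist_cut d x L) q"
          by (rule forces_upper_dist_cutI) (use \<epsilon> q in simp)
      qed
      then show "e' \<le> (lower (dist_cut d x L) p \<^bold>\<or> upper (dist_cut d x L) q)"
        by (rule le_supI2)
    qed
  qed
qed

lemma forces_dist_cut_ex_upper:
  fixes c :: "'h::frame"
  assumes metric: "c \<le> is_metric M d" and subset: "c \<le> is_subset M d L" and x: "c \<le> M x"
    and qtb: "c \<le> quasi_totally_bounded M d L"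
  shows "c \<le> (\<^bold>\<exists>q. upper (dist_cut d x L) q)"
  using qtb zero_less_one
proof (rule forces_quasiapproximationE)
  fix e xs assume e: "e \<le> c" and xs: "e \<le> quasiapproximation M d L (rat_cut 1) xs"
  note fs = order_trans[OF e]
  have "e \<le> \<lbrakk>xs \<noteq> []\<rbrakk>"
    using xs by (simp add: quasiapproximation_def)
  then show "e \<le> (\<^bold>\<exists>q. upper (dist_cut d x L) q)"
  proof (rule forces_tvE)
    \<comment> \<open>Any centre will do: some rational \<open>b\<close> exceeds its distance from
      \<open>x\<close>, and then \<open>b + 1\<close> cannot be a bound.\<close>
    assume "xs \<noteq> []"
    then obtain z where z: "z \<in> set xs"
      by fastforce
    then have "e \<le> M z"
      using xs by (auto simp: quasiapproximation_def le_INF_iff)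
    then have "e \<le> is_real (d x z)"
      by (rule forces_dist_real[OF fs[OF metric] fs[OF x]])
    then have "e \<le> (\<^bold>\<exists>b. upper (d x z) b)"
      by (rule forces_ex_upper)
    then show ?thesis
    proof (rule forces_exE)
      fix b e' assume e': "e' \<le> e" "e' \<le> upper (d x z) b"
      note fs' = order_trans[OF e'(1)]
      have "e' \<le> (\<^bold>\<not> dist_bound d x L (b + 1))"
        by (rule forces_not_dist_bound_approx[OF fs'[OF fs[OF metric]] fs'[OF fs[OF subset]]
              fs'[OF fs[OF x]] fs'[OF xs] z e'(2)])
      \<comment> \<open>Not \<open>b + 1\<close>: the upper part requires a non-bound strictly
        below.\<close>
      then have "e' \<le> upper (dist_cut d x L) (b + 2)"
        by (rule forces_upper_dist_cutI) simp
      then show "e' \<le> (\<^bold>\<exists>q. upper (dist_cut d x L) q)"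
        by (rule forces_exI)
    qed
  qed
qed

lemma forces_dist_cut_real:
  fixes c :: "'h::frame"
  assumes metric: "c \<le> is_metric M d" and subset: "c \<le> is_subset M d L" and x: "c \<le> M x"
    and qtb: "c \<le> quasi_totally_bounded M d L"
  shows "c \<le> is_real (dist_cut d x L)"
proof (rule forces_is_realI)
  have "c \<le> lower (dist_cut d x L) (- 2)"
    by (rule forces_lower_dist_cutI[OF forces_dist_bound_neg[OF metric subset x, of "- 1"]]) simp_all
  then show "c \<le> (\<^bold>\<exists>q. lower (dist_cut d x L) q)"
    by (rule forces_exI)
  show "lower (dist_cut d x L) p = (\<^bold>\<exists>q. \<lbrakk>p < q\<rbrakk> \<^bold>\<and> lower (dist_cut d x L) q)" for p
    unfolding dist_cut_def cut.sel by (rule ex_greater_idem)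
  show "upper (dist_cut d x L) q = (\<^bold>\<exists>p. \<lbrakk>p < q\<rbrakk> \<^bold>\<and> upper (dist_cut d x L) p)" for q
    unfolding dist_cut_def cut.sel by (rule ex_less_idem)
  fix e q
  assume e: "e \<le> c" and low: "e \<le> lower (dist_cut d x L) q" and up: "e \<le> upper (dist_cut d x L) q"
  from low show "e \<le> bot"
  proof (rule forces_lower_dist_cutE)
    fix e' p assume e': "e' \<le> e" "e' \<le> dist_bound d x L p" and p: "q < p"
    from order_trans[OF e'(1) up] show "e' \<le> bot"
    proof (rule forces_upper_dist_cutE)
      fix e'' p' assume e'': "e'' \<le> e'" "e'' \<le> (\<^bold>\<not> dist_bound d x L p')" and p': "p' < q"
      note fs = order_trans[OF e''(1) order_trans[OF e'(1) order_trans[OF e]]]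
      \<comment> \<open>Here \<open>p' < q < p\<close> with \<open>p\<close> a bound, so by downward
        closure \<open>p'\<close> is one as well, against the assumption.\<close>
      show "e'' \<le> bot"
        by (rule forces_mp[OF e''(2)],
            rule forces_dist_bound_mono[OF fs[OF metric] fs[OF subset] fs[OF x]
              order_trans[OF e''(1) e'(2)]])
          (use p p' in simp)
    qed
  qed
qed (fact forces_dist_cut_ex_upper[OF assms] forces_dist_cut_located[OF assms])+

section \<open>The distance cut is the greatest lower bound\<close>

text \<open>Once the cut is a real, the order is a comparison of lower parts. A rational below the
  cut lies below some bound, hence below every distance; a rational below a lower bound
  \<open>r\<close> lies below another rational less than \<open>r\<close>, which is a bound.\<close>

lemma forces_dist_cut_glb:
  fixes c :: "'h::frame"
  assumes metric: "c \<le> is_metric M d" and subset: "c \<le> is_subset M d L" and x: "c \<le> M x"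
    and qtb: "c \<le> quasi_totally_bounded M d L"
  shows "c \<le> is_glb (distances d x L) (dist_cut d x L)"
  unfolding is_glb_def lower_bounds_def le_inf_iff
proof (intro conjI forces_allI forces_impI forces_dist_cut_real[OF assms])
  fix t e e'
  assume "e \<le> c" "e' \<le> e" and real: "e \<le> is_real t" and "e' \<le> distances d x L t"
  from this(4) show "e' \<le> (dist_cut d x L \<^bold>\<le> t)"
    unfolding distances_def
  proof (rule forces_exE, unfold real_eq_def le_inf_iff, elim conjE)
    fix y f assume f: "f \<le> e'" "f \<le> L y" "f \<le> (d x y \<^bold>\<le> t)"
    show "f \<le> (dist_cut d x L \<^bold>\<le> t)"
    proof (rule forces_leI)
      fix f' q assume f': "f' \<le> f" "f' \<le> lower (dist_cut d x L) q"
      from f'(2) show "f' \<le> lower t q"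
      proof (rule forces_lower_dist_cutE)
        fix g p assume g: "g \<le> f'" "q < p" "g \<le> dist_bound d x L p"
        have gf: "g \<le> f" and gr: "g \<le> is_real t"
          using g(1) f'(1) f(1) \<open>e' \<le> e\<close> real by auto
        have "g \<le> lower t p"
          by (rule forces_leD[OF order_trans[OF gf f(3)]
                forces_dist_boundD[OF g(3) order_trans[OF gf f(2)]]])
        then show "g \<le> lower t q"
          by (rule forces_lower_mono[OF gr]) (use g(2) in simp)
      qed
    qed
  qed
next
  fix r e
  assume ec: "e \<le> c"
    and "e \<le> (is_real r \<^bold>\<and> (\<^bold>\<forall>t. is_real t \<^bold>\<longrightarrow> distances d x L t \<^bold>\<longrightarrow> r \<^bold>\<le> t))"
  then have real: "e \<le> is_real r"
    and bound: "e \<le> (is_real t \<^bold>\<longrightarrow> distances d x L t \<^bold>\<longrightarrow> r \<^bold>\<le> t)" for t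
    by (auto dest: forces_allD)
  show "e \<le> (r \<^bold>\<le> dist_cut d x L)"
  proof (rule forces_leI)
    fix f q assume f: "f \<le> e" "f \<le> lower r q"
    \<comment> \<open>Openness of \<open>r\<close> provides the rational \<open>p\<close> with
      \<open>q < p < r\<close>; a bound strictly above \<open>q\<close> is what the lower part of
      \<open>dist_cut\<close> demands.\<close>
    from forces_lower_open[OF order_trans[OF f(1) real] f(2)]
    show "f \<le> lower (dist_cut d x L) q"
    proof (rule forces_exE, unfold le_inf_iff, elim conjE forces_tvE)
      fix p f' assume f': "f' \<le> f" "f' \<le> lower r p" and "q < p"
      have "f' \<le> dist_bound d x L p"
      proof (rule forces_dist_boundI)
        fix g y assume g: "g \<le> f'" "g \<le> L y"
        have ge: "g \<le> e"
          using g(1) f'(1) f(1) by simp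
        note fs = order_trans[OF ge order_trans[OF ec]]
        have "g \<le> is_real (d x y)"
          by (intro forces_dist_real[OF fs[OF metric] fs[OF x]] forces_subsetD[OF fs[OF subset] g(2)])
        \<comment> \<open>The lower bound property is applied to the distance \<open>d x y\<close>
          itself, so that \<open>p < r \<le> d x y\<close>.\<close>
        then have "g \<le> (distances d x L (d x y) \<^bold>\<longrightarrow> r \<^bold>\<le> d x y)"
          by (rule forces_mp[OF order_trans[OF ge bound]])
        moreover have "g \<le> distances d x L (d x y)"
          unfolding distances_def
          by (rule forces_exI[where x = y]) (simp add: g(2) forces_eq_refl)
        ultimately have "g \<le> (r \<^bold>\<le> d x y)"
          by (rule forces_mp)
        then show "g \<le> lower (d x y) p"
          using order_trans[OF g(1) f'(2)] by (rule forces_leD)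
      qed
      then show "f' \<le> lower (dist_cut d x L) q"
        using \<open>q < p\<close> by (rule forces_lower_dist_cutI)
    qed
  qed
qed

theorem mainTheorem10:
  fixes M :: "'a \<Rightarrow> 'h::frame"
    and d :: "'a \<Rightarrow> 'a \<Rightarrow> 'h cut"
    and L :: "'a \<Rightarrow> 'h"
  shows "\<Turnstile> is_metric M d \<^bold>\<and> is_subset M d L \<^bold>\<and> quasi_totally_bounded M d L
           \<^bold>\<longrightarrow> quasilocated M d L"
  unfolding valid_def quasilocated_def
proof (rule top_le, intro forces_impI forces_allI)
  fix x e e'
  assume "e \<le> (is_metric M d \<^bold>\<and> is_subset M d L \<^bold>\<and> quasi_totally_bounded M d L)"
    and "e' \<le> e" "e' \<le> M x"
  \<comment> \<open>The witness is one explicit cut, independent of any choice of approximations, so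
    no choice principle enters.\<close>
  then have "e' \<le> is_glb (distances d x L) (dist_cut d x L)"
    by (intro forces_dist_cut_glb[where M = M]) (auto intro: order_trans)
  then show "e' \<le> (\<^bold>\<exists>g. is_glb (distances d x L) g)"
    by (rule forces_exI)
qed

end
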